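(* Let $n\ge 1$ and let $\mathbf{f}=\{f_0,\ldots,f_m\}\subset R=k[x_0,\ldots,x_n]$ be monomials of the same degree satisfying the canonical restrictions. If $\mathbf{f}$ defines a birational map onto its image, then so does its Newton complementary dual set $\widehat{\mathbf{f}}$.
   Context: $k$ is an infinite field. Canonical restrictions: $\gcd\{f_0,\ldots,f_m\}=1$ and every variable $x_i$ appears effectively in some $f_j$ (the common degree being $\ge 1$). Newton complementary dual of a set of monomials: for $0\le i\le n$ let $\alpha_i$ be the maximum of the exponents of $x_i$ in the monomials $f_0,\ldots,f_m$, and put $\mathbf{x}^{\underline{\alpha}}=x_0^{\alpha_0}\cdots x_n^{\alpha_n}$. Then $\widehat{f_j}:=\mathbf{x}^{\underline{\alpha}}/f_j$ and $\widehat{\mathbf{f}}:=\{\widehat{f_0},\ldots,\widehat{f_m}\}$. A set $\mathbf{g}=\{g_0,\ldots,g_m\}$ of forms of the same degree $e$ in $R$ defines the rational map $(g_0:\cdots:g_m):\mathbb{P}^n\dashrightarrow\mathbb{P}^m$; it is birational onto its image if and only if $k(g_0,\ldots,g_m)=k(\mathbf{x}_e)$, where $\mathbf{x}_e$ is the set of all monomials of degree $e$ in $x_0,\ldots,x_n$. *)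

theory Defs
  imports
    "HOL-Library.Poly_Mapping"
    "HOL-Computational_Algebra.Fraction_Field"
    "HOL-Algebra.Generated_Fields"
    "HOL-Algebra.Algebraic_Closure_Type"
begin

text \<open>
  Polynomials over \<open>k\<close> in the variables \<open>x\<^sub>0, x\<^sub>1, \<dots>\<close>; the ring \<open>k[x\<^sub>0,\<dots>,x\<^sub>n]\<close> is the subset
  \<open>mpoly_ring n\<close>, and its field of fractions is regarded inside the type of fractions of the
  full polynomial type. Exponent vectors are finitely supported functions, so that
  \<open>Poly_Mapping.single a 1\<close> is the monomial with exponent vector \<open>a\<close>.
\<close>

type_synonym 'a mpoly = "(nat \<Rightarrow>\<^sub>0 nat) \<Rightarrow>\<^sub>0 'a"

definition Const :: "'a::field \<Rightarrow> 'a mpoly" where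
  "Const c = Poly_Mapping.single 0 c"

definition Var :: "nat \<Rightarrow> 'a::field mpoly" where
  "Var i = Poly_Mapping.single (Poly_Mapping.single i 1) 1"

definition total_degree :: "(nat \<Rightarrow>\<^sub>0 nat) \<Rightarrow> nat" where
  "total_degree a = (\<Sum>i\<in>Poly_Mapping.keys a. Poly_Mapping.lookup a i)"

definition mpoly_ring :: "nat \<Rightarrow> 'a::field mpoly set" where
  "mpoly_ring n = {p. \<forall>a\<in>Poly_Mapping.keys p. Poly_Mapping.keys a \<subseteq> {..n}}"

definition forms :: "nat \<Rightarrow> nat \<Rightarrow> 'a::field mpoly set" where
  "forms n e = {p \<in> mpoly_ring n. \<forall>a\<in>Poly_Mapping.keys p. total_degree a = e}"

definition monomials :: "nat \<Rightarrow> 'a::field mpoly set" where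
  "monomials n = {Poly_Mapping.single a 1 |a. Poly_Mapping.keys a \<subseteq> {..n}}"

text \<open>The exponent of \<open>x\<^sub>i\<close> in \<open>p\<close>, meaningful only if \<open>p\<close> is a monomial.\<close>

definition exponent :: "'a::field mpoly \<Rightarrow> nat \<Rightarrow> nat" where
  "exponent p i = Poly_Mapping.lookup (THE a. p = Poly_Mapping.single a 1) i"

text \<open>
  A set \<open>{f\<^sub>0,\<dots>,f\<^sub>m}\<close> is given as a family \<open>f\<close> of which only the values \<open>f j\<close> with \<open>j \<le> m\<close> matter.
  The second conjunct says that the gcd is 1: every common divisor is a unit.
\<close>

definition canonical_restrictions :: "nat \<Rightarrow> nat \<Rightarrow> (nat \<Rightarrow> 'a::field mpoly) \<Rightarrow> bool" where
  "canonical_restrictions n m f \<longleftrightarrow>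
     (\<exists>d\<ge>1. \<forall>j\<le>m. f j \<in> forms n d) \<and>
     (\<forall>h\<in>mpoly_ring n. (\<forall>j\<le>m. h dvd f j) \<longrightarrow> h dvd 1) \<and>
     (\<forall>i\<le>n. \<exists>j\<le>m. exponent (f j) i > 0)"

definition max_exponents_monomial :: "nat \<Rightarrow> nat \<Rightarrow> (nat \<Rightarrow> 'a::field mpoly) \<Rightarrow> 'a mpoly" where
  "max_exponents_monomial n m f = (\<Prod>i\<le>n. Var i ^ Max ((\<lambda>j. exponent (f j) i) ` {..m}))"

text \<open>The exact quotient of \<open>max_exponents_monomial n m f\<close> by \<open>f j\<close> in the polynomial ring.\<close>

definition newton_dual :: "nat \<Rightarrow> nat \<Rightarrow> (nat \<Rightarrow> 'a::field mpoly) \<Rightarrow> nat \<Rightarrow> 'a mpoly" where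
  "newton_dual n m f j = (THE q. q * f j = max_exponents_monomial n m f)"

text \<open>The subfield \<open>k(S)\<close> of the field of fractions generated by \<open>k\<close> and \<open>S\<close>.\<close>

definition to_fraction :: "'a::field mpoly \<Rightarrow> 'a mpoly fract" where
  "to_fraction p = Fract p 1"

definition generated_subfield :: "'a::field mpoly set \<Rightarrow> 'a mpoly fract set" where
  "generated_subfield S =
     generate_field ring_of_type_algebra (Set.range (\<lambda>c. to_fraction (Const c)) \<union> to_fraction ` S)"

text \<open>
  Birationality onto the image of the rational map \<open>(g\<^sub>0 : \<dots> : g\<^sub>m)\<close> given by forms of the same
  degree \<open>e\<close>. Constants are excluded: for \<open>e = 0\<close> the equality of fields says nothing about
  the constant map. The equivalence with the existence of an inverse rational map is
  \<open>generated_subfield_eq_iff_inverse\<close> below.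
\<close>

definition birational_onto_image :: "nat \<Rightarrow> nat \<Rightarrow> (nat \<Rightarrow> 'a::field mpoly) \<Rightarrow> bool" where
  "birational_onto_image n m g \<longleftrightarrow>
     (\<exists>e\<ge>1. (\<forall>j\<le>m. g j \<in> forms n e) \<and>
        generated_subfield (g ` {..m}) = generated_subfield (monomials n \<inter> forms n e))"


subsection \<open>Comparison with inverse rational maps\<close>

definition substitute :: "nat \<Rightarrow> (nat \<Rightarrow> 'a::field mpoly) \<Rightarrow> 'a mpoly \<Rightarrow> 'a mpoly" where
  "substitute m g h =
     (\<Sum>b\<in>Poly_Mapping.keys h. Const (Poly_Mapping.lookup h b) *
        (\<Prod>j\<le>m. g j ^ Poly_Mapping.lookup b j))"

text \<open>Exponents and total degree\<close>

lemma keys_add_nat: "Poly_Mapping.keys (a + b) = Poly_Mapping.keys a \<union> Poly_Mapping.keys b"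
  for a b :: "nat \<Rightarrow>\<^sub>0 nat"
  by (auto simp: in_keys_iff lookup_add)

lemma total_degree_superset:
  assumes "finite B" "Poly_Mapping.keys a \<subseteq> B"
  shows "total_degree a = (\<Sum>i\<in>B. Poly_Mapping.lookup a i)"
  unfolding total_degree_def
  by (rule sum.mono_neutral_left) (use assms in \<open>auto simp: in_keys_iff\<close>)

lemma total_degree_add: "total_degree (a + b) = total_degree a + total_degree b"
proof -
  let ?B = "Poly_Mapping.keys a \<union> Poly_Mapping.keys b"
  have "total_degree (a + b) = (\<Sum>i\<in>?B. Poly_Mapping.lookup (a + b) i)"
    by (rule total_degree_superset) (auto simp: keys_add_nat)
  also have "\<dots> = (\<Sum>i\<in>?B. Poly_Mapping.lookup a i) + (\<Sum>i\<in>?B. Poly_Mapping.lookup b i)"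
    by (simp add: lookup_add sum.distrib)
  also have "\<dots> = total_degree a + total_degree b"
    by (subst (1 2) total_degree_superset[of ?B]) auto
  finally show ?thesis .
qed

lemma total_degree_single [simp]: "total_degree (Poly_Mapping.single i c) = c"
  by (simp add: total_degree_def)

lemma total_degree_zero [simp]: "total_degree 0 = 0"
  by (simp add: total_degree_def)

text \<open>Forms\<close>

lemma forms_zero [simp]: "0 \<in> forms n e"
  by (simp add: forms_def mpoly_ring_def)

lemma forms_add: "p \<in> forms n e \<Longrightarrow> q \<in> forms n e \<Longrightarrow> p + q \<in> forms n e"
  using Poly_Mapping.keys_add[of p q] by (fastforce simp: forms_def mpoly_ring_def)

lemma forms_sum: "(\<And>x. x \<in> A \<Longrightarrow> F x \<in> forms n e) \<Longrightarrow> sum F A \<in> forms n e"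
  by (induction A rule: infinite_finite_induct) (auto intro: forms_add)

lemma forms_mult:
  assumes "p \<in> forms n d" "q \<in> forms n e"
  shows "p * q \<in> forms n (d + e)"
proof -
  have "Poly_Mapping.keys c \<subseteq> {..n} \<and> total_degree c = d + e"
    if "c \<in> Poly_Mapping.keys (p * q)" for c
  proof -
    from that keys_mult[of p q] obtain a b where
      "c = a + b" "a \<in> Poly_Mapping.keys p" "b \<in> Poly_Mapping.keys q" by auto
    with assms show ?thesis
      by (auto simp: forms_def mpoly_ring_def keys_add_nat total_degree_add)
  qed
  then show ?thesis by (auto simp: forms_def mpoly_ring_def)
qed

lemma forms_Const [simp]: "Const c \<in> forms n 0"
  by (auto simp: forms_def mpoly_ring_def Const_def)

lemma forms_one [simp]: "1 \<in> forms n 0"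
  by (auto simp: forms_def mpoly_ring_def)

lemma forms_Var: "i \<le> n \<Longrightarrow> Var i \<in> forms n 1"
  by (auto simp: forms_def mpoly_ring_def Var_def)

lemma forms_power: "p \<in> forms n e \<Longrightarrow> p ^ r \<in> forms n (r * e)"
  by (induction r) (auto dest: forms_mult)

lemma forms_prod:
  "finite A \<Longrightarrow> (\<And>x. x \<in> A \<Longrightarrow> F x \<in> forms n (d x)) \<Longrightarrow> prod F A \<in> forms n (sum d A)"
  by (induction A rule: finite_induct) (auto intro: forms_mult)

text \<open>Homogeneous components\<close>

lemma expand_singles: "p = (\<Sum>a\<in>Poly_Mapping.keys p. Poly_Mapping.single a (Poly_Mapping.lookup p a))"
  by (rule poly_mapping_eqI)
     (auto simp: lookup_sum lookup_single when_def in_keys_iff)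

definition component :: "nat \<Rightarrow> 'a::field mpoly \<Rightarrow> 'a mpoly" where
  "component t p = (\<Sum>a\<in>{a\<in>Poly_Mapping.keys p. total_degree a = t}.
     Poly_Mapping.single a (Poly_Mapping.lookup p a))"

lemma lookup_component:
  "Poly_Mapping.lookup (component t p) a = (if total_degree a = t then Poly_Mapping.lookup p a else 0)"
  by (auto simp: component_def lookup_sum lookup_single when_def in_keys_iff)

lemma component_form: "p \<in> mpoly_ring n \<Longrightarrow> component t p \<in> forms n t"
  by (auto simp: forms_def mpoly_ring_def in_keys_iff lookup_component split: if_splits)

lemma sum_components:
  assumes "finite T" "total_degree ` Poly_Mapping.keys p \<subseteq> T"
  shows "p = (\<Sum>t\<in>T. component t p)"
proof (rule poly_mapping_eqI)
  fix a
  show "Poly_Mapping.lookup p a = Poly_Mapping.lookup (\<Sum>t\<in>T. component t p) a"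
    using assms by (auto simp: lookup_sum lookup_component in_keys_iff image_subset_iff)
qed

lemma component_of_sum:
  assumes "finite T" "t \<in> T" "inj_on d T" "\<And>s. s \<in> T \<Longrightarrow> F s \<in> forms n (d s)"
  shows "component (d t) (\<Sum>s\<in>T. F s) = F t"
proof (rule poly_mapping_eqI)
  fix a
  have *: "Poly_Mapping.lookup (F s) a = 0" if "s \<in> T" "total_degree a \<noteq> d s" for s
    using assms(4)[OF that(1)] that(2) by (auto simp: forms_def in_keys_iff)
  show "Poly_Mapping.lookup (component (d t) (\<Sum>s\<in>T. F s)) a = Poly_Mapping.lookup (F t) a"
  proof (cases "total_degree a = d t")
    case True
    have "(\<Sum>s\<in>T. Poly_Mapping.lookup (F s) a) = (\<Sum>s\<in>{t}. Poly_Mapping.lookup (F s) a)"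
    proof (rule sum.mono_neutral_right)
      show "\<forall>s\<in>T - {t}. Poly_Mapping.lookup (F s) a = 0"
        using True * assms(2,3) by (auto dest: inj_onD)
    qed (use assms in auto)
    with True show ?thesis by (simp add: lookup_component lookup_sum)
  next
    case False
    with * assms(2) show ?thesis by (simp add: lookup_component)
  qed
qed

lemma component_Var_mult:
  assumes "p \<in> mpoly_ring n" "i \<le> n"
  shows "component (s + 1) (Var i * p) = Var i * component s p"
proof -
  let ?T = "insert s (total_degree ` Poly_Mapping.keys p)"
  have "Var i * p = (\<Sum>t\<in>?T. Var i * component t p)"
    by (subst sum_components[of ?T p]) (auto simp: sum_distrib_left)
  also have "component (s + 1) \<dots> = Var i * component s p"
    by (rule component_of_sum[where n = n])
       (use assms forms_mult[OF forms_Var component_form] in \<open>auto simp: inj_on_def\<close>)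
  finally show ?thesis .
qed

text \<open>Substitution is a ring homomorphism\<close>

lemma Const_add: "Const (c + d) = Const c + Const d"
  by (simp add: Const_def single_add)

lemma Const_mult: "Const (c * d) = Const c * Const d"
  by (simp add: Const_def mult_single)

lemma Const_0 [simp]: "Const 0 = 0"
  by (simp add: Const_def)

lemma Const_1 [simp]: "Const 1 = 1"
  by (simp add: Const_def)

lemma substitute_superset:
  assumes "finite B" "Poly_Mapping.keys h \<subseteq> B"
  shows "substitute m g h =
     (\<Sum>b\<in>B. Const (Poly_Mapping.lookup h b) * (\<Prod>j\<le>m. g j ^ Poly_Mapping.lookup b j))"
  unfolding substitute_def
  by (rule sum.mono_neutral_left) (use assms in \<open>auto simp: in_keys_iff\<close>)

lemma substitute_zero [simp]: "substitute m g 0 = 0"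
  by (simp add: substitute_def)

lemma substitute_add: "substitute m g (p + q) = substitute m g p + substitute m g q"
proof -
  let ?B = "Poly_Mapping.keys p \<union> Poly_Mapping.keys q"
  have "substitute m g (p + q) =
      (\<Sum>b\<in>?B. Const (Poly_Mapping.lookup (p + q) b) * (\<Prod>j\<le>m. g j ^ Poly_Mapping.lookup b j))"
    by (rule substitute_superset) (use Poly_Mapping.keys_add[of p q] in auto)
  also have "\<dots> = substitute m g p + substitute m g q"
    by (subst (1 2) substitute_superset[of ?B])
       (auto simp: lookup_add Const_add algebra_simps sum.distrib)
  finally show ?thesis .
qed

lemma substitute_sum: "substitute m g (\<Sum>x\<in>A. F x) = (\<Sum>x\<in>A. substitute m g (F x))"
  by (induction A rule: infinite_finite_induct) (auto simp: substitute_add)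

lemma substitute_single:
  "substitute m g (Poly_Mapping.single b c) = Const c * (\<Prod>j\<le>m. g j ^ Poly_Mapping.lookup b j)"
  by (subst substitute_superset[of "{b}"]) auto

lemma substitute_mult: "substitute m g (p * q) = substitute m g p * substitute m g q"
proof -
  let ?P = "Poly_Mapping.keys p" and ?Q = "Poly_Mapping.keys q"
  let ?s = "\<lambda>p a. Poly_Mapping.single a (Poly_Mapping.lookup p a)"
  have "p * q = (\<Sum>a\<in>?P. ?s p a) * (\<Sum>b\<in>?Q. ?s q b)"
    using expand_singles[of p] expand_singles[of q] by simp
  then have "substitute m g (p * q) = (\<Sum>a\<in>?P. \<Sum>b\<in>?Q. substitute m g (?s p a * ?s q b))"
    by (simp add: sum_product substitute_sum)
  also have "\<dots> = (\<Sum>a\<in>?P. \<Sum>b\<in>?Q. substitute m g (?s p a) * substitute m g (?s q b))"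
    by (intro sum.cong refl)
       (simp add: mult_single substitute_single lookup_add power_add prod.distrib Const_mult mult_ac)
  also have "\<dots> = substitute m g (\<Sum>a\<in>?P. ?s p a) * substitute m g (\<Sum>b\<in>?Q. ?s q b)"
    by (simp add: sum_product substitute_sum)
  also have "\<dots> = substitute m g p * substitute m g q"
    using expand_singles[of p] expand_singles[of q] by simp
  finally show ?thesis .
qed

lemma substitute_Const [simp]: "substitute m g (Const c) = Const c"
  unfolding Const_def by (subst substitute_single) (simp add: Const_def)

lemma substitute_one [simp]: "substitute m g 1 = 1"
  using substitute_Const[of m g 1] by (simp del: substitute_Const)

lemma substitute_prod: "substitute m g (\<Prod>x\<in>A. F x) = (\<Prod>x\<in>A. substitute m g (F x))"
  by (induction A rule: infinite_finite_induct) (auto simp: substitute_mult)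

lemma substitute_Var:
  assumes "j \<le> m"
  shows "substitute m g (Var j) = g j"
proof -
  have "(\<Prod>l\<le>m. g l ^ Poly_Mapping.lookup (Poly_Mapping.single j 1) l) = (\<Prod>l\<le>m. if l = j then g l else 1)"
    by (intro prod.cong) (auto simp: lookup_single when_def)
  with assms show ?thesis by (simp add: Var_def substitute_single prod.delta)
qed

lemma substitute_form:
  assumes "h \<in> forms m D" "\<And>j. j \<le> m \<Longrightarrow> g j \<in> forms n e"
  shows "substitute m g h \<in> forms n (D * e)"
  unfolding substitute_def
proof (rule forms_sum)
  fix b assume b: "b \<in> Poly_Mapping.keys h"
  with assms(1) have "D = (\<Sum>j\<le>m. Poly_Mapping.lookup b j)"
    by (subst total_degree_superset[symmetric]) (auto simp: forms_def mpoly_ring_def)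
  moreover have "(\<Prod>j\<le>m. g j ^ Poly_Mapping.lookup b j) \<in> forms n (\<Sum>j\<le>m. Poly_Mapping.lookup b j * e)"
    by (rule forms_prod) (use assms(2) in \<open>auto intro: forms_power\<close>)
  ultimately show "Const (Poly_Mapping.lookup h b) * (\<Prod>j\<le>m. g j ^ Poly_Mapping.lookup b j) \<in> forms n (D * e)"
    using forms_mult[OF forms_Const] by (fastforce simp: sum_distrib_right)
qed

lemma mpoly_ring_add: "p \<in> mpoly_ring n \<Longrightarrow> q \<in> mpoly_ring n \<Longrightarrow> p + q \<in> mpoly_ring n"
  using Poly_Mapping.keys_add[of p q] by (fastforce simp: mpoly_ring_def)

lemma mpoly_ring_uminus: "p \<in> mpoly_ring n \<Longrightarrow> - p \<in> mpoly_ring n"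
  by (simp add: mpoly_ring_def in_keys_iff)

lemma mpoly_ring_mult: "p \<in> mpoly_ring n \<Longrightarrow> q \<in> mpoly_ring n \<Longrightarrow> p * q \<in> mpoly_ring n"
  using keys_mult[of p q] by (fastforce simp: mpoly_ring_def keys_add_nat)

lemma forms_mpoly_ring: "p \<in> forms n e \<Longrightarrow> p \<in> mpoly_ring n"
  by (simp add: forms_def)

lemma component_substitute:
  assumes "h \<in> mpoly_ring m" "\<And>j. j \<le> m \<Longrightarrow> g j \<in> forms n e" "e \<ge> 1"
  shows "component (t * e) (substitute m g h) = substitute m g (component t h)"
proof -
  let ?T = "insert t (total_degree ` Poly_Mapping.keys h)"
  have "substitute m g h = (\<Sum>s\<in>?T. substitute m g (component s h))"
    by (subst sum_components[of ?T h]) (auto simp: substitute_sum)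
  also have "component (t * e) \<dots> = substitute m g (component t h)"
    by (rule component_of_sum[where n = n and d = "\<lambda>s. s * e"])
       (use assms in \<open>auto simp: inj_on_def intro: substitute_form component_form\<close>)
  finally show ?thesis .
qed

text \<open>Generated subfields in terms of type class operations\<close>

lemma ring_of_type_algebra_field: "Ring.field (ring_of_type_algebra :: 'b::field ring)"
  by (rule field_from_type_algebra)

lemma ring_of_type_algebra_a_inv: "\<ominus>\<^bsub>ring_of_type_algebra\<^esub> x = - (x :: 'b::field)"
proof -
  interpret Ring.field "ring_of_type_algebra :: 'b ring"
    by (rule ring_of_type_algebra_field)
  show ?thesis
    by (rule minus_equality) (simp_all add: ring_of_type_algebra_def)
qed

lemma ring_of_type_algebra_m_inv:
  "x \<noteq> 0 \<Longrightarrow> inv\<^bsub>ring_of_type_algebra\<^esub> x = inverse (x :: 'b::field)"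
proof -
  assume "x \<noteq> 0"
  interpret Ring.field "ring_of_type_algebra :: 'b ring"
    by (rule ring_of_type_algebra_field)
  show ?thesis
    by (rule comm_inv_char) (use \<open>x \<noteq> 0\<close> in \<open>simp_all add: ring_of_type_algebra_def\<close>)
qed

lemma generated_subfield_closed:
  shows "1 \<in> generated_subfield S"
    and "to_fraction (Const c) \<in> generated_subfield S"
    and "p \<in> S \<Longrightarrow> to_fraction p \<in> generated_subfield S"
    and "x \<in> generated_subfield S \<Longrightarrow> y \<in> generated_subfield S \<Longrightarrow> x + y \<in> generated_subfield S"
    and "x \<in> generated_subfield S \<Longrightarrow> y \<in> generated_subfield S \<Longrightarrow> x * y \<in> generated_subfield S"
    and "x \<in> generated_subfield S \<Longrightarrow> - x \<in> generated_subfield S"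
    and "x \<in> generated_subfield S \<Longrightarrow> x \<noteq> 0 \<Longrightarrow> inverse x \<in> generated_subfield S"
proof -
  show "1 \<in> generated_subfield S"
    using generate_field.one[where R = ring_of_type_algebra]
    by (auto simp: generated_subfield_def ring_of_type_algebra_def)
  show "to_fraction (Const c) \<in> generated_subfield S"
    by (auto simp: generated_subfield_def intro: generate_field.incl)
  show "p \<in> S \<Longrightarrow> to_fraction p \<in> generated_subfield S"
    by (auto simp: generated_subfield_def intro: generate_field.incl)
  show "x \<in> generated_subfield S \<Longrightarrow> y \<in> generated_subfield S \<Longrightarrow> x + y \<in> generated_subfield S"
    using generate_field.eng_add[where R = ring_of_type_algebra]
    by (fastforce simp: generated_subfield_def ring_of_type_algebra_def)
  show "x \<in> generated_subfield S \<Longrightarrow> y \<in> generated_subfield S \<Longrightarrow> x * y \<in> generated_subfield S"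
    using generate_field.eng_mult[where R = ring_of_type_algebra]
    by (fastforce simp: generated_subfield_def ring_of_type_algebra_def)
  show "x \<in> generated_subfield S \<Longrightarrow> - x \<in> generated_subfield S"
    unfolding generated_subfield_def
    by (subst ring_of_type_algebra_a_inv[symmetric]) (rule generate_field.a_inv)
  show "x \<in> generated_subfield S \<Longrightarrow> x \<noteq> 0 \<Longrightarrow> inverse x \<in> generated_subfield S"
    unfolding generated_subfield_def
    by (subst ring_of_type_algebra_m_inv[symmetric], assumption, rule generate_field.m_inv)
       (auto simp: ring_of_type_algebra_def)
qed

lemma generated_subfield_induct [consumes 1, case_names one const incl uminus inverse add mult]:
  assumes "x \<in> generated_subfield S"
    and "P 1" "\<And>c. P (to_fraction (Const c))" "\<And>p. p \<in> S \<Longrightarrow> P (to_fraction p)"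
    and uminus: "\<And>x. P x \<Longrightarrow> P (- x)" and inverse: "\<And>x. P x \<Longrightarrow> x \<noteq> 0 \<Longrightarrow> P (inverse x)"
    and "\<And>x y. P x \<Longrightarrow> P y \<Longrightarrow> P (x + y)" "\<And>x y. P x \<Longrightarrow> P y \<Longrightarrow> P (x * y)"
  shows "P x"
  using assms(1) unfolding generated_subfield_def
proof (induction rule: generate_field.induct)
  case (a_inv h)
  then show ?case using uminus by (simp add: ring_of_type_algebra_a_inv)
next
  case (m_inv h)
  then have "h \<noteq> 0" by (simp add: ring_of_type_algebra_def)
  with m_inv show ?case using inverse by (simp add: ring_of_type_algebra_m_inv)
qed (use assms in \<open>auto simp: ring_of_type_algebra_def\<close>)

lemma to_fraction_simps [simp]:
  "to_fraction 0 = 0" "to_fraction 1 = 1" "to_fraction (p + q) = to_fraction p + to_fraction q"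
  "to_fraction (- p) = - to_fraction p" "to_fraction (p * q) = to_fraction p * to_fraction q"
  "to_fraction p = 0 \<longleftrightarrow> p = 0" "to_fraction p = to_fraction q \<longleftrightarrow> p = q"
  by (auto simp: to_fraction_def Zero_fract_def One_fract_def eq_fract)

lemma to_fraction_sum: "to_fraction (\<Sum>x\<in>A. F x) = (\<Sum>x\<in>A. to_fraction (F x))"
  by (induction A rule: infinite_finite_induct) auto

lemma to_fraction_prod: "to_fraction (\<Prod>x\<in>A. F x) = (\<Prod>x\<in>A. to_fraction (F x))"
  by (induction A rule: infinite_finite_induct) auto

lemma to_fraction_power: "to_fraction (p ^ r) = to_fraction p ^ r"
  by (induction r) auto

lemma generated_subfield_zero: "0 \<in> generated_subfield S"
  using generated_subfield_closed(2)[of 0] by simp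

lemma generated_subfield_sum:
  "(\<And>x. x \<in> A \<Longrightarrow> F x \<in> generated_subfield S) \<Longrightarrow> sum F A \<in> generated_subfield S"
  by (induction A rule: infinite_finite_induct)
     (auto intro: generated_subfield_closed generated_subfield_zero)

lemma generated_subfield_prod:
  "(\<And>x. x \<in> A \<Longrightarrow> F x \<in> generated_subfield S) \<Longrightarrow> prod F A \<in> generated_subfield S"
  by (induction A rule: infinite_finite_induct) (auto intro: generated_subfield_closed)

lemma generated_subfield_power: "x \<in> generated_subfield S \<Longrightarrow> x ^ r \<in> generated_subfield S"
  by (induction r) (auto intro: generated_subfield_closed)

lemma generated_subfield_divide:
  "x \<in> generated_subfield S \<Longrightarrow> y \<in> generated_subfield S \<Longrightarrow> x / y \<in> generated_subfield S"
  by (cases "y = 0")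
     (auto simp: divide_inverse intro: generated_subfield_closed generated_subfield_zero)

lemma generated_subfield_subset:
  assumes "\<And>p. p \<in> S \<Longrightarrow> to_fraction p \<in> generated_subfield T"
  shows "generated_subfield S \<subseteq> generated_subfield T"
proof
  fix x assume "x \<in> generated_subfield S"
  then show "x \<in> generated_subfield T"
    by (induction rule: generated_subfield_induct) (auto intro: generated_subfield_closed assms)
qed

lemma generated_subfield_quotient:
  assumes "x \<in> generated_subfield (g ` {..m})"
  obtains p q where "p \<in> mpoly_ring m" "q \<in> mpoly_ring m" "substitute m g q \<noteq> 0"
    "x = to_fraction (substitute m g p) / to_fraction (substitute m g q)"
proof -
  let ?P = "\<lambda>x. \<exists>p q. p \<in> mpoly_ring m \<and> q \<in> mpoly_ring m \<and> substitute m g q \<noteq> 0 \<and>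
    x = to_fraction (substitute m g p) / to_fraction (substitute m g q)"
  have poly: "?P (to_fraction (substitute m g p))" if "p \<in> mpoly_ring m" for p
    using that by (intro exI[of _ p] exI[of _ 1]) (auto intro: forms_mpoly_ring[OF forms_one])
  have um: "substitute m g (- p) = - substitute m g p" for p
    using substitute_add[of m g p "- p"] by (simp add: add_eq_0_iff)
  from assms have "?P x"
  proof (induction rule: generated_subfield_induct)
    case one
    show ?case using poly[OF forms_mpoly_ring[OF forms_one]] by simp
  next
    case (const c)
    show ?case using poly[OF forms_mpoly_ring[OF forms_Const]] by simp
  next
    case (incl p)
    then obtain j where "j \<le> m" "p = g j" by auto
    then show ?case
      using poly[OF forms_mpoly_ring[OF forms_Var[OF \<open>j \<le> m\<close>]]] by (simp add: substitute_Var)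
  next
    case (uminus x)
    then obtain p q where "p \<in> mpoly_ring m" "q \<in> mpoly_ring m" "substitute m g q \<noteq> 0"
      "x = to_fraction (substitute m g p) / to_fraction (substitute m g q)" by blast
    then show ?case by (intro exI[of _ "- p"] exI[of _ q]) (auto simp: um mpoly_ring_uminus)
  next
    case (inverse x)
    then obtain p q where "p \<in> mpoly_ring m" "q \<in> mpoly_ring m" "substitute m g q \<noteq> 0"
      "x = to_fraction (substitute m g p) / to_fraction (substitute m g q)" by blast
    with inverse show ?case by (intro exI[of _ q] exI[of _ p]) auto
  next
    case (add x y)
    then obtain p q p' q' where "p \<in> mpoly_ring m" "q \<in> mpoly_ring m" "substitute m g q \<noteq> 0"
      "x = to_fraction (substitute m g p) / to_fraction (substitute m g q)"
      "p' \<in> mpoly_ring m" "q' \<in> mpoly_ring m" "substitute m g q' \<noteq> 0"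
      "y = to_fraction (substitute m g p') / to_fraction (substitute m g q')" by blast
    then show ?case
      by (intro exI[of _ "p * q' + p' * q"] exI[of _ "q * q'"])
         (auto simp: substitute_add substitute_mult mpoly_ring_add mpoly_ring_mult add_frac_eq)
  next
    case (mult x y)
    then obtain p q p' q' where "p \<in> mpoly_ring m" "q \<in> mpoly_ring m" "substitute m g q \<noteq> 0"
      "x = to_fraction (substitute m g p) / to_fraction (substitute m g q)"
      "p' \<in> mpoly_ring m" "q' \<in> mpoly_ring m" "substitute m g q' \<noteq> 0"
      "y = to_fraction (substitute m g p') / to_fraction (substitute m g q')" by blast
    then show ?case
      by (intro exI[of _ "p * p'"] exI[of _ "q * q'"])
         (auto simp: substitute_mult mpoly_ring_mult)
  qed
  with that show ?thesis by blast
qed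

text \<open>Monomials\<close>

lemma Var_neq_0 [simp]: "Var i \<noteq> 0"
  by (metis Var_def lookup_single_eq lookup_zero one_neq_zero)

lemma single_eq_prod_Var:
  assumes "Poly_Mapping.keys a \<subseteq> {..n}"
  shows "Poly_Mapping.single a 1 = (\<Prod>i\<le>n. Var i ^ Poly_Mapping.lookup a i)"
proof -
  have pow: "Var i ^ r = Poly_Mapping.single (Poly_Mapping.single i r) 1" for i r
    by (induction r) (auto simp: Var_def mult_single single_add[symmetric])
  have pr: "(\<Prod>i\<in>A. Poly_Mapping.single (b i) 1) = Poly_Mapping.single (\<Sum>i\<in>A. b i) 1"
    if "finite A" for A and b :: "nat \<Rightarrow> (nat \<Rightarrow>\<^sub>0 nat)"
    using that by (induction A rule: finite_induct) (auto simp: mult_single)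
  have "a = (\<Sum>i\<le>n. Poly_Mapping.single i (Poly_Mapping.lookup a i))"
    using assms
    by (intro poly_mapping_eqI) (auto simp: lookup_sum lookup_single when_def in_keys_iff subset_iff)
  then show ?thesis by (simp add: pow pr)
qed

lemma monomial_in_forms:
  "Poly_Mapping.keys a \<subseteq> {..n} \<Longrightarrow> total_degree a = e \<Longrightarrow>
    Poly_Mapping.single a 1 \<in> monomials n \<inter> forms n e"
  by (auto simp: monomials_def forms_def mpoly_ring_def)

lemma form_expand:
  "p = (\<Sum>a\<in>Poly_Mapping.keys p. Const (Poly_Mapping.lookup p a) * Poly_Mapping.single a 1)"
  by (subst expand_singles) (simp add: Const_def mult_single)

text \<open>
  The rational map with coordinates \<open>g\<close> is birational onto its image iff there are forms
  \<open>h\<^sub>0,\<dots>,h\<^sub>n\<close> of the same degree, not all vanishing on the image, such that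
  \<open>(h\<^sub>0(g) : \<dots> : h\<^sub>n(g)) = (x\<^sub>0 : \<dots> : x\<^sub>n)\<close>.
\<close>

theorem generated_subfield_eq_iff_inverse:
  fixes g :: "nat \<Rightarrow> 'a::field mpoly"
  assumes e: "e \<ge> 1" and g: "\<And>j. j \<le> m \<Longrightarrow> g j \<in> forms n e" and nz: "\<exists>j\<le>m. g j \<noteq> 0"
  shows "generated_subfield (g ` {..m}) = generated_subfield (monomials n \<inter> forms n e) \<longleftrightarrow>
    (\<exists>D h. (\<forall>i\<le>n. h i \<in> forms m D) \<and> (\<exists>i\<le>n. substitute m g (h i) \<noteq> 0) \<and>
       (\<forall>i\<le>n. \<forall>j\<le>n. substitute m g (h i) * Var j = substitute m g (h j) * Var i))"
    (is "?K = ?L \<longleftrightarrow> ?inverse")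
proof
  assume eq: "?K = ?L"
  have "\<exists>t p q. p \<in> forms m t \<and> q \<in> forms m t \<and> substitute m g q \<noteq> 0 \<and>
      Var i * substitute m g q = Var 0 * substitute m g p" if i: "i \<le> n" for i
  proof -
    let ?v = "\<lambda>i. Poly_Mapping.single i 1 + Poly_Mapping.single 0 (e - 1) :: nat \<Rightarrow>\<^sub>0 nat"
    have mem: "to_fraction (Poly_Mapping.single (?v i) 1 :: 'a mpoly) \<in> ?K" if "i \<le> n" for i
      unfolding eq
      by (rule generated_subfield_closed(3), rule monomial_in_forms)
         (use that e in \<open>auto simp: keys_add_nat total_degree_add split: if_splits\<close>)
    have v: "Poly_Mapping.single (?v i) 1 = Var i * (Poly_Mapping.single (Poly_Mapping.single 0 (e - 1)) 1 :: 'a mpoly)" for i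
      by (simp add: Var_def mult_single)
    have "(Poly_Mapping.single (Poly_Mapping.single 0 (e - 1)) 1 :: 'a mpoly) \<noteq> 0"
      by (metis lookup_single_eq lookup_zero one_neq_zero)
    then have "to_fraction (Var i :: 'a mpoly) / to_fraction (Var 0) \<in> ?K"
      using generated_subfield_divide[OF mem[OF i] mem[of 0]] unfolding v by simp
    then obtain p q where pq: "p \<in> mpoly_ring m" "q \<in> mpoly_ring m" "substitute m g q \<noteq> 0"
      "to_fraction (Var i) / to_fraction (Var 0) =
        to_fraction (substitute m g p) / to_fraction (substitute m g q)"
      by (rule generated_subfield_quotient)
    then have "to_fraction (Var i * substitute m g q) = to_fraction (Var 0 * substitute m g p)"
      by (simp add: frac_eq_eq mult.commute del: to_fraction_simps(7))
    then have main: "Var i * substitute m g q = Var 0 * substitute m g p"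
      by (simp only: to_fraction_simps(7))
    have "substitute m g q = (\<Sum>t\<in>total_degree ` Poly_Mapping.keys q. substitute m g (component t q))"
      by (subst sum_components[of "total_degree ` Poly_Mapping.keys q" q]) (auto simp: substitute_sum)
    with pq(3) obtain t where t: "substitute m g (component t q) \<noteq> 0"
      by (metis (no_types, lifting) sum.neutral)
    have sub: "substitute m g r \<in> mpoly_ring n" if "r \<in> mpoly_ring m" for r
    proof -
      have "substitute m g r = (\<Sum>t\<in>total_degree ` Poly_Mapping.keys r. substitute m g (component t r))"
        by (subst sum_components[of "total_degree ` Poly_Mapping.keys r" r]) (auto simp: substitute_sum)
      also have "\<dots> \<in> mpoly_ring n"
      proof -
        have "(\<Sum>t\<in>A. substitute m g (component t r)) \<in> mpoly_ring n" for A
          by (induction A rule: infinite_finite_induct)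
             (auto intro!: mpoly_ring_add forms_mpoly_ring[OF substitute_form[OF component_form[OF that] g]]
                simp: forms_mpoly_ring[OF forms_zero])
        then show ?thesis .
      qed
      finally show ?thesis .
    qed
    have "Var i * component (t * e) (substitute m g q) = Var 0 * component (t * e) (substitute m g p)"
      using component_Var_mult[OF sub[OF pq(2)] i, of "t * e"]
        component_Var_mult[OF sub[OF pq(1)], of 0 "t * e"] main by simp
    then have "Var i * substitute m g (component t q) = Var 0 * substitute m g (component t p)"
      using component_substitute[of _ m g n e t] pq(1,2) g e by simp
    with t pq show ?thesis by (blast intro: component_form)
  qed
  then obtain t p q where *: "\<And>i. i \<le> n \<Longrightarrow> p i \<in> forms m (t i)"
    "\<And>i. i \<le> n \<Longrightarrow> q i \<in> forms m (t i)" "\<And>i. i \<le> n \<Longrightarrow> substitute m g (q i) \<noteq> 0"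
    "\<And>i. i \<le> n \<Longrightarrow> Var i * substitute m g (q i) = Var 0 * substitute m g (p i)"
    by metis
  define h where "h i = p i * (\<Prod>l\<in>{..n} - {i}. q l)" for i
  define W where "W = (\<Prod>l\<le>n. substitute m g (q l))"
  have W: "W \<noteq> 0" using *(3) by (simp add: W_def)
  have hW: "Var 0 * substitute m g (h i) = Var i * W" if "i \<le> n" for i
  proof -
    have "W = substitute m g (q i) * (\<Prod>l\<in>{..n} - {i}. substitute m g (q l))"
      unfolding W_def by (rule prod.remove) (use that in auto)
    with *(4)[OF that] show ?thesis
      by (simp add: h_def substitute_mult substitute_prod mult.assoc[symmetric])
  qed
  have "\<forall>i\<le>n. h i \<in> forms m (\<Sum>l\<le>n. t l)"
  proof (intro allI impI)
    fix i assume i: "i \<le> n"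
    have "(\<Sum>l\<le>n. t l) = t i + (\<Sum>l\<in>{..n} - {i}. t l)"
      by (rule sum.remove) (use i in auto)
    with i *(1,2) show "h i \<in> forms m (\<Sum>l\<le>n. t l)"
      unfolding h_def by (auto intro!: forms_mult forms_prod)
  qed
  moreover have "substitute m g (h 0) \<noteq> 0"
    using hW[of 0] W by auto
  moreover have "substitute m g (h i) * Var j = substitute m g (h j) * Var i" if "i \<le> n" "j \<le> n" for i j
  proof -
    have "Var 0 * (substitute m g (h i) * Var j) = Var 0 * (substitute m g (h j) * Var i)"
      by (simp only: mult.assoc[symmetric] hW that) (simp add: mult_ac)
    then show ?thesis by simp
  qed
  ultimately show ?inverse by blast
next
  assume ?inverse
  then obtain D h l where h: "\<And>i. i \<le> n \<Longrightarrow> h i \<in> forms m D"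
    and l: "l \<le> n" "substitute m g (h l) \<noteq> 0"
    and hh: "\<And>i j. i \<le> n \<Longrightarrow> j \<le> n \<Longrightarrow> substitute m g (h i) * Var j = substitute m g (h j) * Var i"
    by blast
  have gK: "to_fraction (g j) \<in> ?K" if "j \<le> m" for j
    using that by (auto intro: generated_subfield_closed)
  have subK: "to_fraction (substitute m g p) \<in> ?K" for p
    unfolding substitute_def
    by (auto simp: to_fraction_sum to_fraction_prod to_fraction_power intro!: generated_subfield_sum
        generated_subfield_closed(2,5) generated_subfield_prod generated_subfield_power gK)
  have h0: "substitute m g (h 0) \<noteq> 0"
    using hh[OF l(1), of 0] l(2) by auto
  have ratio: "to_fraction (Var i :: 'a mpoly) / to_fraction (Var 0) \<in> ?K" if "i \<le> n" for i
  proof -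
    have "to_fraction (substitute m g (h i) * Var 0) = to_fraction (substitute m g (h 0) * Var i)"
      using hh[OF that, of 0] by simp
    then have "to_fraction (Var i) / to_fraction (Var 0) =
        to_fraction (substitute m g (h i)) / to_fraction (substitute m g (h 0))"
      using h0 by (simp add: frac_eq_eq mult.commute del: to_fraction_simps(7))
    with subK show ?thesis by (metis generated_subfield_divide)
  qed
  have mon: "to_fraction (Poly_Mapping.single a 1 :: 'a mpoly) / to_fraction (Var 0) ^ e \<in> ?K"
    if "Poly_Mapping.keys a \<subseteq> {..n}" "total_degree a = e" for a
  proof -
    have "e = (\<Sum>i\<le>n. Poly_Mapping.lookup a i)"
      using that by (subst total_degree_superset[symmetric]) auto
    then have "to_fraction (Poly_Mapping.single a 1 :: 'a mpoly) / to_fraction (Var 0) ^ e =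
        (\<Prod>i\<le>n. (to_fraction (Var i) / to_fraction (Var 0)) ^ Poly_Mapping.lookup a i)"
      by (simp add: single_eq_prod_Var[OF that(1)] to_fraction_prod to_fraction_power
          power_divide prod_dividef power_sum)
    also have "\<dots> \<in> ?K"
      by (auto intro!: generated_subfield_prod generated_subfield_power ratio)
    finally show ?thesis .
  qed
  obtain j where j: "j \<le> m" "g j \<noteq> 0" using nz by blast
  have "to_fraction (g j) / to_fraction (Var 0) ^ e =
      (\<Sum>a\<in>Poly_Mapping.keys (g j). to_fraction (Const (Poly_Mapping.lookup (g j) a)) *
        (to_fraction (Poly_Mapping.single a 1) / to_fraction (Var 0) ^ e))"
    by (subst form_expand) (simp add: to_fraction_sum sum_divide_distrib)
  also have "\<dots> \<in> ?K"
    using g[OF j(1)]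
    by (auto intro!: generated_subfield_sum generated_subfield_closed(2,5) mon
        simp: forms_def mpoly_ring_def simp del: times_divide_eq_right)
  finally have "to_fraction (g j) / (to_fraction (g j) / to_fraction (Var 0) ^ e) \<in> ?K"
    using gK[OF j(1)] generated_subfield_divide by blast
  then have x0: "to_fraction (Var 0) ^ e \<in> ?K" using j(2) by simp
  show "?K = ?L"
  proof
    show "?L \<subseteq> ?K"
    proof (rule generated_subfield_subset)
      fix p :: "'a mpoly" assume "p \<in> monomials n \<inter> forms n e"
      then obtain a where a: "p = Poly_Mapping.single a 1" "Poly_Mapping.keys a \<subseteq> {..n}" "total_degree a = e"
        by (auto simp: monomials_def forms_def)
      have "to_fraction p / to_fraction (Var 0) ^ e * to_fraction (Var 0) ^ e \<in> ?K"
        using mon[OF a(2,3)] x0 a(1) generated_subfield_closed(5) by blast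
      then show "to_fraction p \<in> ?K" by simp
    qed
    show "?K \<subseteq> ?L"
    proof (rule generated_subfield_subset)
      fix p assume "p \<in> g ` {..m}"
      with g have p: "p \<in> forms n e" by auto
      have "to_fraction p = (\<Sum>a\<in>Poly_Mapping.keys p.
          to_fraction (Const (Poly_Mapping.lookup p a)) * to_fraction (Poly_Mapping.single a 1))"
        by (subst form_expand) (simp add: to_fraction_sum)
      also have "\<dots> \<in> ?L"
        using p by (auto intro!: generated_subfield_sum generated_subfield_closed(2,3,5)
            simp: forms_def mpoly_ring_def monomials_def)
      finally show "to_fraction p \<in> ?L" .
    qed
  qed
qed

end

theory Submission
  imports Defs
begin

text \<open>
  Write \<open>u(g)\<close> for \<open>substitute m g u\<close>. The proof compares the inverse maps of the two sets. A set of
  monomials that is birational onto its image has an inverse whose coordinates \<open>u\<^sub>0,\<dots>,u\<^sub>n\<close> are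
  themselves monomials (\<open>monomial_inverse\<close>), so that \<open>(u\<^sub>0(f) : \<dots> : u\<^sub>n(f)) = (x\<^sub>0 : \<dots> : x\<^sub>n)\<close>.

  Let \<open>g\<^sub>j\<close> be the members of the dual set and \<open>M = g\<^sub>j f\<^sub>j\<close>, which does not depend on \<open>j\<close>. A monomial
  \<open>u\<close> of degree \<open>D\<close> satisfies \<open>u(g) u(f) = M\<^sup>D\<close> (\<open>substitute_complementary\<close>). The \<open>u\<^sub>i\<close> all have the
  same degree, hence \<open>(u\<^sub>0(g) : \<dots> : u\<^sub>n(g)) = (1/x\<^sub>0 : \<dots> : 1/x\<^sub>n)\<close>. Composing with the standard Cremona
  involution, that is, passing to \<open>w\<^sub>i = \<Prod>\<^bsub>l\<noteq>i\<^esub> u\<^sub>l\<close>, gives \<open>(w\<^sub>0(g) : \<dots> : w\<^sub>n(g)) = (x\<^sub>0 : \<dots> : x\<^sub>n)\<close>, so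
  the \<open>w\<^sub>i\<close> are the coordinates of an inverse of the dual map. The passage between equality
  of fields and existence of an inverse is \<open>generated_subfield_eq_iff_inverse\<close>.
\<close>

lemma single_one_neq_0 [simp]: "Poly_Mapping.single a 1 \<noteq> (0 :: 'a::field mpoly)"
  by (metis lookup_single_eq lookup_zero one_neq_zero)

lemma single_one_eq_iff [simp]:
  "Poly_Mapping.single a 1 = (Poly_Mapping.single b 1 :: 'a::field mpoly) \<longleftrightarrow> a = b"
  by (metis keys_single singleton_inject one_neq_zero)

lemma exponent_single: "exponent (Poly_Mapping.single a 1 :: 'a::field mpoly) i = Poly_Mapping.lookup a i"
  unfolding exponent_def by simp

lemma monomials_neq_0: "p \<in> monomials n \<Longrightarrow> p \<noteq> 0"
  by (auto simp: monomials_def)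

lemma monomials_degree_0:
  assumes "p \<in> monomials n" "p \<in> forms n 0"
  shows "p = 1"
proof -
  obtain a where a: "p = Poly_Mapping.single a 1" "total_degree a = 0"
    using assms by (auto simp: monomials_def forms_def)
  then have "a = 0"
    by (intro poly_mapping_eqI) (auto simp: total_degree_def in_keys_iff)
  with a show ?thesis by simp
qed

lemma monomials_one: "1 \<in> monomials n"
  unfolding monomials_def by (intro CollectI exI[of _ 0]) simp

lemma monomials_mult:
  assumes "p \<in> monomials n" "q \<in> monomials n"
  shows "p * q \<in> monomials n"
proof -
  obtain a b where "p = Poly_Mapping.single a 1" "Poly_Mapping.keys a \<subseteq> {..n}"
    "q = Poly_Mapping.single b 1" "Poly_Mapping.keys b \<subseteq> {..n}"
    using assms by (auto simp: monomials_def)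
  then show ?thesis
    unfolding monomials_def by (intro CollectI exI[of _ "a + b"]) (auto simp: mult_single keys_add_nat)
qed

lemma monomials_power: "p \<in> monomials n \<Longrightarrow> p ^ r \<in> monomials n"
  by (induction r) (auto intro: monomials_one monomials_mult)

lemma monomials_prod: "(\<And>x. x \<in> A \<Longrightarrow> F x \<in> monomials n) \<Longrightarrow> prod F A \<in> monomials n"
  by (induction A rule: infinite_finite_induct) (auto intro: monomials_one monomials_mult)

lemma substitute_single_monomials:
  assumes "\<And>j. j \<le> m \<Longrightarrow> g j \<in> monomials n"
  shows "substitute m g (Poly_Mapping.single b 1) \<in> monomials n"
  unfolding substitute_single
  by (auto intro!: monomials_prod monomials_power assms)

text \<open>
  Substituting monomials sends each term of \<open>h\<close> to a scalar multiple of a single monomial; a monomial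
  of the sum must come from at least one term, even though terms may collide and cancel.
\<close>

lemma keys_substitute_monomials:
  assumes g: "\<And>j. j \<le> m \<Longrightarrow> g j \<in> monomials n"
    and c: "c \<in> Poly_Mapping.keys (substitute m g h)"
  shows "\<exists>b\<in>Poly_Mapping.keys h. substitute m g (Poly_Mapping.single b 1) = Poly_Mapping.single c 1"
proof -
  have eq: "substitute m g h = (\<Sum>b\<in>Poly_Mapping.keys h.
      Const (Poly_Mapping.lookup h b) * substitute m g (Poly_Mapping.single b 1))"
    unfolding substitute_def[of m g h] by (simp add: substitute_single)
  have "\<exists>b\<in>Poly_Mapping.keys h. c \<in> Poly_Mapping.keys
      (Const (Poly_Mapping.lookup h b) * substitute m g (Poly_Mapping.single b 1))"
  proof (rule ccontr)
    assume "\<not> ?thesis"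
    then have "Poly_Mapping.lookup (substitute m g h) c = 0"
      unfolding eq by (auto simp: lookup_sum in_keys_iff)
    with c show False by (simp add: in_keys_iff)
  qed
  then obtain b where b: "b \<in> Poly_Mapping.keys h" "c \<in> Poly_Mapping.keys
      (Const (Poly_Mapping.lookup h b) * substitute m g (Poly_Mapping.single b 1))"
    by blast
  obtain a where "substitute m g (Poly_Mapping.single b 1) = Poly_Mapping.single a 1"
    using substitute_single_monomials[of m g n b, OF g] unfolding monomials_def by blast
  with b show ?thesis
    by (auto simp: Const_def mult_single split: if_splits)
qed

lemma keys_mult_Var:
  "Poly_Mapping.keys (p * Var i) = (\<lambda>a. a + Poly_Mapping.single i 1) ` Poly_Mapping.keys p"
proof -
  have expand: "p * Var i = (\<Sum>a\<in>Poly_Mapping.keys p.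
      Poly_Mapping.single (a + Poly_Mapping.single i 1) (Poly_Mapping.lookup p a))"
    by (subst expand_singles[of p]) (simp add: sum_distrib_right Var_def mult_single)
  have "Poly_Mapping.lookup (p * Var i) (a + Poly_Mapping.single i 1) = Poly_Mapping.lookup p a" for a
    unfolding expand by (simp add: lookup_sum lookup_single when_def in_keys_iff)
  moreover have "Poly_Mapping.keys (p * Var i) \<subseteq> (\<lambda>a. a + Poly_Mapping.single i 1) ` Poly_Mapping.keys p"
    using keys_mult[of p "Var i"] by (auto simp: Var_def)
  ultimately show ?thesis
    by (auto simp: in_keys_iff)
qed

text \<open>
  Any inverse \<open>h\<close> can be replaced by a monomial one. One monomial \<open>c\<close> of \<open>h\<^sub>l(g)\<close> is chosen once and for
  all. The relation \<open>h\<^sub>i(g) x\<^sub>l = h\<^sub>l(g) x\<^sub>i\<close> forces \<open>c x\<^sub>i / x\<^sub>l\<close> to occur in \<open>h\<^sub>i(g)\<close>, hence to be the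
  image of some monomial \<open>u\<^sub>i\<close> of \<open>h\<^sub>i\<close>. Because \<open>c\<close> is common to all \<open>i\<close>, these images are proportional
  to \<open>x\<^sub>0,\<dots>,x\<^sub>n\<close>.
\<close>

lemma monomial_inverse:
  fixes g :: "nat \<Rightarrow> 'a::field mpoly"
  assumes e: "e \<ge> 1" and g: "\<And>j. j \<le> m \<Longrightarrow> g j \<in> monomials n \<inter> forms n e"
    and eq: "generated_subfield (g ` {..m}) = generated_subfield (monomials n \<inter> forms n e)"
  obtains D u where "\<And>i. i \<le> n \<Longrightarrow> u i \<in> monomials m \<inter> forms m D"
    "\<And>i j. i \<le> n \<Longrightarrow> j \<le> n \<Longrightarrow> substitute m g (u i) * Var j = substitute m g (u j) * Var i"
proof -
  have gm: "g j \<in> monomials n" if "j \<le> m" for j using g that by blast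
  have gf: "g j \<in> forms n e" if "j \<le> m" for j using g that by blast
  have nz: "\<exists>j\<le>m. g j \<noteq> 0" using monomials_neq_0[OF gm, of 0] by blast
  obtain D h l where h: "\<And>i. i \<le> n \<Longrightarrow> h i \<in> forms m D"
    and l: "l \<le> n" "substitute m g (h l) \<noteq> 0"
    and hh: "\<And>i j. i \<le> n \<Longrightarrow> j \<le> n \<Longrightarrow> substitute m g (h i) * Var j = substitute m g (h j) * Var i"
    using iffD1[OF generated_subfield_eq_iff_inverse[OF e gf nz] eq] by metis
  obtain c where c: "c \<in> Poly_Mapping.keys (substitute m g (h l))"
    using l(2) by fastforce
  have "\<exists>b c'. b \<in> Poly_Mapping.keys (h i) \<and>
      substitute m g (Poly_Mapping.single b 1) = Poly_Mapping.single c' 1 \<and>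
      c' + Poly_Mapping.single l 1 = c + Poly_Mapping.single i 1" if i: "i \<le> n" for i
  proof -
    have "c + Poly_Mapping.single i 1 \<in> Poly_Mapping.keys (substitute m g (h i) * Var l)"
      unfolding hh[OF i l(1)] keys_mult_Var using c by blast
    then obtain c' where "c' \<in> Poly_Mapping.keys (substitute m g (h i))"
      "c' + Poly_Mapping.single l 1 = c + Poly_Mapping.single i 1"
      unfolding keys_mult_Var by force
    moreover from this(1) obtain b where "b \<in> Poly_Mapping.keys (h i)"
      "substitute m g (Poly_Mapping.single b 1) = Poly_Mapping.single c' 1"
      using keys_substitute_monomials[of m g n c' "h i", OF gm] by blast
    ultimately show ?thesis by blast
  qed
  then obtain b c' where b: "\<And>i. i \<le> n \<Longrightarrow> b i \<in> Poly_Mapping.keys (h i)"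
    and c': "\<And>i. i \<le> n \<Longrightarrow> substitute m g (Poly_Mapping.single (b i) 1) = Poly_Mapping.single (c' i) 1"
    and shift: "\<And>i. i \<le> n \<Longrightarrow> c' i + Poly_Mapping.single l 1 = c + Poly_Mapping.single i 1"
    by metis
  show ?thesis
  proof
    fix i assume "i \<le> n"
    then show "Poly_Mapping.single (b i) 1 \<in> monomials m \<inter> forms m D"
      using b h by (intro monomial_in_forms) (auto simp: forms_def mpoly_ring_def)
  next
    fix i j assume ij: "i \<le> n" "j \<le> n"
    have "(c' i + Poly_Mapping.single l 1) + Poly_Mapping.single j 1
        = (c' j + Poly_Mapping.single l 1) + Poly_Mapping.single i 1"
      by (simp only: shift ij add_ac)
    then have "(c' i + Poly_Mapping.single j 1) + Poly_Mapping.single l 1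
        = (c' j + Poly_Mapping.single i 1) + Poly_Mapping.single l 1"
      by (simp only: add_ac)
    then have "c' i + Poly_Mapping.single j 1 = c' j + Poly_Mapping.single i 1"
      by simp
    then show "substitute m g (Poly_Mapping.single (b i) 1) * Var j
        = substitute m g (Poly_Mapping.single (b j) 1) * Var i"
      by (simp add: c' ij Var_def mult_single)
  qed
qed

text \<open>
  The quotient that defines the dual exists because the exponents of \<open>f\<^sub>j\<close> are bounded by their maxima,
  and it is unique because the polynomial ring is a domain.
\<close>

lemma newton_dual_monomials:
  fixes f :: "nat \<Rightarrow> 'a::field mpoly"
  assumes f: "\<And>j. j \<le> m \<Longrightarrow> f j \<in> monomials n \<inter> forms n d"
  obtains e where "\<And>j. j \<le> m \<Longrightarrow> newton_dual n m f j \<in> monomials n \<inter> forms n e"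
    "\<And>j. j \<le> m \<Longrightarrow> newton_dual n m f j * f j = max_exponents_monomial n m f"
proof -
  have "\<exists>a. f j = Poly_Mapping.single a 1 \<and> Poly_Mapping.keys a \<subseteq> {..n} \<and> total_degree a = d"
    if "j \<le> m" for j
    using f[OF that] by (auto simp: monomials_def forms_def)
  then obtain a where a: "\<And>j. j \<le> m \<Longrightarrow> f j = Poly_Mapping.single (a j) 1"
    "\<And>j. j \<le> m \<Longrightarrow> Poly_Mapping.keys (a j) \<subseteq> {..n}"
    "\<And>j. j \<le> m \<Longrightarrow> total_degree (a j) = d"
    by metis
  define A where "A i = Max ((\<lambda>j. exponent (f j) i) ` {..m})" for i
  define \<alpha> where "\<alpha> = (\<Sum>i\<le>n. Poly_Mapping.single i (A i))"
  have lookup_\<alpha>: "Poly_Mapping.lookup \<alpha> i = (if i \<le> n then A i else 0)" for i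
    by (simp add: \<alpha>_def lookup_sum lookup_single when_def)
  have keys_\<alpha>: "Poly_Mapping.keys \<alpha> \<subseteq> {..n}"
    by (auto simp: in_keys_iff lookup_\<alpha> split: if_splits)
  have M: "max_exponents_monomial n m f = Poly_Mapping.single \<alpha> 1"
    unfolding single_eq_prod_Var[OF keys_\<alpha>] max_exponents_monomial_def
    by (intro prod.cong) (auto simp: lookup_\<alpha> A_def)
  have diff: "\<alpha> - a j + a j = \<alpha>" if j: "j \<le> m" for j
  proof (rule poly_mapping_eqI)
    fix i
    have "Poly_Mapping.lookup (a j) i \<le> Poly_Mapping.lookup \<alpha> i"
    proof (cases "i \<le> n")
      case True
      have "exponent (f j) i \<le> A i"
        unfolding A_def by (rule Max_ge) (use j in auto)
      then show ?thesis using True j by (simp add: a(1) exponent_single lookup_\<alpha>)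
    next
      case False
      then have "i \<notin> Poly_Mapping.keys (a j)" using a(2)[OF j] by auto
      then show ?thesis by (simp add: in_keys_iff)
    qed
    then show "Poly_Mapping.lookup (\<alpha> - a j + a j) i = Poly_Mapping.lookup \<alpha> i"
      by (simp add: lookup_add lookup_minus)
  qed
  have quot: "Poly_Mapping.single (\<alpha> - a j) 1 * f j = max_exponents_monomial n m f" if "j \<le> m" for j
    by (simp add: a(1) M mult_single diff that)
  have dual: "newton_dual n m f j = Poly_Mapping.single (\<alpha> - a j) 1" if j: "j \<le> m" for j
    unfolding newton_dual_def
  proof (rule the_equality)
    fix q assume "q * f j = max_exponents_monomial n m f"
    then have "q * f j = Poly_Mapping.single (\<alpha> - a j) 1 * f j" using quot[OF j] by simp
    then show "q = Poly_Mapping.single (\<alpha> - a j) 1" using j by (simp add: a(1))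
  qed (rule quot[OF j])
  show ?thesis
  proof
    fix j assume j: "j \<le> m"
    have "total_degree (\<alpha> - a j) = total_degree \<alpha> - d"
      using total_degree_add[of "\<alpha> - a j" "a j"] j by (simp add: diff a(3))
    moreover have "Poly_Mapping.keys (\<alpha> - a j) \<subseteq> {..n}"
      using keys_\<alpha> keys_add_nat[of "\<alpha> - a j" "a j"] diff[OF j] by auto
    ultimately show "newton_dual n m f j \<in> monomials n \<inter> forms n (total_degree \<alpha> - d)"
      unfolding dual[OF j] by (intro monomial_in_forms)
    show "newton_dual n m f j * f j = max_exponents_monomial n m f"
      using quot j by (simp add: dual)
  qed
qed

lemma substitute_complementary:
  assumes "\<And>j. j \<le> m \<Longrightarrow> g' j * g j = M" "u \<in> monomials m \<inter> forms m D"
  shows "substitute m g' u * substitute m g u = M ^ D"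
proof -
  obtain b where b: "u = Poly_Mapping.single b 1" "Poly_Mapping.keys b \<subseteq> {..m}" "total_degree b = D"
    using assms(2) by (auto simp: monomials_def forms_def)
  have "substitute m g' u * substitute m g u = (\<Prod>j\<le>m. (g' j * g j) ^ Poly_Mapping.lookup b j)"
    by (simp add: b(1) substitute_single prod.distrib power_mult_distrib)
  also have "\<dots> = (\<Prod>j\<le>m. M ^ Poly_Mapping.lookup b j)"
    by (intro prod.cong) (simp_all add: assms(1))
  also have "\<dots> = M ^ D"
    using b(2,3) by (simp add: power_sum[symmetric] total_degree_superset[of "{..m}"])
  finally show ?thesis .
qed

theorem proposition1p6:
  fixes n m :: nat and f :: "nat \<Rightarrow> 'a::field mpoly"
  assumes "infinite (UNIV :: 'a set)"
    and "n \<ge> 1"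
    and "\<forall>j\<le>m. f j \<in> monomials n"
    and "canonical_restrictions n m f"
    and "birational_onto_image n m f"
  shows "birational_onto_image n m (newton_dual n m f)"
proof -
  obtain d where d: "d \<ge> 1" and fd: "\<And>j. j \<le> m \<Longrightarrow> f j \<in> monomials n \<inter> forms n d"
    and eq: "generated_subfield (f ` {..m}) = generated_subfield (monomials n \<inter> forms n d)"
    using assms(3,5) by (auto simp: birational_onto_image_def)
  obtain D u where u: "\<And>i. i \<le> n \<Longrightarrow> u i \<in> monomials m \<inter> forms m D"
    and uu: "\<And>i j. i \<le> n \<Longrightarrow> j \<le> n \<Longrightarrow> substitute m f (u i) * Var j = substitute m f (u j) * Var i"
    by (rule monomial_inverse[of d m f n, OF d fd eq]) blast+
  define g where "g = newton_dual n m f"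
  define M where "M = max_exponents_monomial n m f"
  obtain e where g: "\<And>j. j \<le> m \<Longrightarrow> g j \<in> monomials n \<inter> forms n e"
    and gf: "\<And>j. j \<le> m \<Longrightarrow> g j * f j = M"
    using newton_dual_monomials[of m f n d, OF fd] unfolding g_def M_def by blast
  define F where "F i = substitute m f (u i)" for i
  define G where "G i = substitute m g (u i)" for i
  have nz: "F i \<noteq> 0" "G i \<noteq> 0" if i: "i \<le> n" for i
  proof -
    obtain b where b: "u i = Poly_Mapping.single b 1"
      using u[OF i] by (auto simp: monomials_def)
    show "F i \<noteq> 0" "G i \<noteq> 0"
      unfolding F_def G_def b
      using substitute_single_monomials[of m f n b] substitute_single_monomials[of m g n b] fd g
      by (blast dest: monomials_neq_0)+
  qed
  have GF: "G i * F i = M ^ D" if "i \<le> n" for i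
    unfolding F_def G_def by (rule substitute_complementary[OF gf u[OF that]])
  (* G i is M ^ D / F i and F i is proportional to x_i: the G i are proportional to 1 / x_i. *)
  have G: "G i * Var i = G j * Var j" if ij: "i \<le> n" "j \<le> n" for i j
  proof -
    have "(G i * Var i) * (F i * F j) = M ^ D * (F j * Var i)"
      using GF[OF ij(1)] by (simp add: mult_ac)
    also have "F j * Var i = F i * Var j" using uu[OF ij] by (simp add: F_def)
    also have "M ^ D * (F i * Var j) = (G j * Var j) * (F i * F j)"
      using GF[OF ij(2)] by (simp add: mult_ac)
    finally show ?thesis using nz ij by simp
  qed
  (* If e = 0 then every g j is 1, so all the G i are 1 as well and x_0 = x_1; these are
     distinct variables of the ring because n >= 1. *)
  have e: "e \<ge> 1"
  proof (rule ccontr)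
    assume "\<not> e \<ge> 1"
    then have "e = 0" by simp
    then have "g j \<in> monomials n \<inter> forms n 0" if "j \<le> m" for j using g[OF that] by simp
    then have g1: "g j = 1" if "j \<le> m" for j
      using that by (auto dest: monomials_degree_0)
    have "G i = 1" if i: "i \<le> n" for i
    proof -
      obtain b where b: "u i = Poly_Mapping.single b 1"
        using u[OF i] by (auto simp: monomials_def)
      show ?thesis
        unfolding G_def b substitute_single by (simp add: g1)
    qed
    then have "Var 0 = (Var 1 :: 'a mpoly)"
      using G[of 0 1] assms(2) by simp
    then have "Poly_Mapping.single 0 1 = (Poly_Mapping.single 1 1 :: nat \<Rightarrow>\<^sub>0 nat)"
      unfolding Var_def single_one_eq_iff .
    then have "Poly_Mapping.keys (Poly_Mapping.single 0 1 :: nat \<Rightarrow>\<^sub>0 nat)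
        = Poly_Mapping.keys (Poly_Mapping.single 1 1 :: nat \<Rightarrow>\<^sub>0 nat)"
      by (rule arg_cong)
    then show False by simp
  qed
  define w where "w i = (\<Prod>l\<in>{..n} - {i}. u l)" for i
  have Gw: "G i * substitute m g (w i) = (\<Prod>l\<le>n. G l)" if "i \<le> n" for i
    using that by (simp add: w_def substitute_prod G_def prod.remove[of "{..n}" i])
  have "w i \<in> forms m (n * D)" if "i \<le> n" for i
  proof -
    have "w i \<in> forms m (\<Sum>l\<in>{..n} - {i}. D)"
      unfolding w_def by (rule forms_prod) (use u in auto)
    with that show ?thesis by simp
  qed
  moreover have "substitute m g (w 0) \<noteq> 0"
    using Gw[of 0] nz by auto
  moreover have "substitute m g (w i) * Var j = substitute m g (w j) * Var i"
    if ij: "i \<le> n" "j \<le> n" for i j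
  proof -
    have "(G i * G j) * (substitute m g (w i) * Var j) = (G i * substitute m g (w i)) * (G j * Var j)"
      by (simp add: mult_ac)
    also have "\<dots> = (G j * substitute m g (w j)) * (G i * Var i)"
      using Gw[OF ij(1)] Gw[OF ij(2)] G[OF ij] by simp
    also have "\<dots> = (G i * G j) * (substitute m g (w j) * Var i)"
      by (simp add: mult_ac)
    finally show ?thesis using nz ij by simp
  qed
  moreover have "g 0 \<noteq> 0" using g[of 0] by (auto dest: monomials_neq_0)
  ultimately have "generated_subfield (g ` {..m}) = generated_subfield (monomials n \<inter> forms n e)"
    by (subst generated_subfield_eq_iff_inverse[OF e]) (use g in blast)+
  with e g show ?thesis
    unfolding birational_onto_image_def g_def by blast
qed

end
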